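(* Let $m,d\ge 1$ be integers, let $\{p(\cdot|\lambda)\}_{\lambda\in\mathbb{R}^d}$ be a family of (strictly positive) probability density functions on $\mathbb{R}^m$, let $\{\lambda_t^*\}_{t\in\mathbb{N}}$ (with $\mathbb{N}=\{1,2,\dots\}$) be a deterministic sequence in $\mathbb{R}^d$, and let $\{X_t\}_{t\in\mathbb{N}}$ be a sequence of independent $m$-dimensional random vectors on a common probability space $(\Omega,\mathcal{F},\mathbb{P})$ such that, for each $t\in\mathbb{N}$, $X_t$ has probability density function $p(\cdot|\lambda_t^* )$. Assume the following. (1) (Smoothness) For every $x\in\mathbb{R}^m$ the function $\mathbb{R}^d\ni\lambda\mapsto \ln p(x|\lambda)$ is twice continuously differentiable; moreover, for all $i,j\in\{1,\dots,d\}$, $t\in\mathbb{N}$ and $\lambda\in\mathbb{R}^d$, $$\partial_{\lambda_i}\partial_{\lambda_j}\mathbb{E}[\ln p(X_t|\lambda)]=\mathbb{E}[\partial_{\lambda_i}\partial_{\lambda_j}\ln p(X_t|\lambda)]$$ (in particular, the quantities on both sides exist). (2) (Strong convexity of the negative log-likelihood) There is a constant $\ell>0$ such that for all $x\in\mathbb{R}^m$ and all $\lambda\in\mathbb{R}^d$ the matrix $\mathcal{H}_\lambda[-\ln p(x|\lambda)]-\ell I_d$ is positive semi-definite. (3) (Lipschitz gradient) There is a constant $L>0$ such that for all $x\in\mathbb{R}^m$ and all $\xi_1,\xi_2\in\mathbb{R}^d$, $$\|\nabla_\lambda\ln p(x|\xi_1)-\nabla_\lambda\ln p(x|\xi_2)\|\le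 L\|\xi_1-\xi_2\|.$$ (4) (Bounded drift) There is a constant $K>0$ such that $\|\lambda_{t+1}^*-\lambda_t^*\|\le K$ for all $t\in\mathbb{N}$. Let $\alpha\in\left[\frac{1}{\ell+L},\frac1L\right)$, let $\lambda_1\in\mathbb{R}^d$ be an arbitrary (deterministic) point, and define recursively $$\lambda_{t+1}:=\lambda_t+\alpha\,\nabla_\lambda\ln p(X_t|\lambda_t),\qquad t\in\mathbb{N}.$$ Then $$\limsup_{t\to+\infty}\|\lambda_{t+1}-\lambda_t^*\|_{\mathbb{L}^2(\Omega)}\le\frac{\varphi(\alpha,L)K+\alpha\sqrt{2dL}}{1-\varphi(\alpha,L)},\qquad\text{where }\varphi(\alpha,L):=\sqrt{1-2L\alpha+2L^2\alpha^2}.$$ Moreover, the minimum over $\alpha\in\left[\frac1{\ell+L},\frac1L\right)$ of the right-hand side above is attained at $\alpha=\frac1{\ell+L}$, and for this choice of $\alpha$ the inequality reads $$\limsup_{t\to+\infty}\|\lambda_{t+1}-\lambda_t^*\|_{\mathbb{L}^2(\Omega)}\le\frac{K\sqrt{\ell^2+L^2}+\sqrt{2dL}}{\ell+L-\sqrt{\ell^2+L^2}}.$$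
   Context: $\mathbb{E}[\cdot]$ denotes expectation with respect to $\mathbb{P}$; $\|\cdot\|$ is the Euclidean norm on $\mathbb{R}^d$; for an $\mathbb{R}^d$-valued random vector $Y$, $\|Y\|_{\mathbb{L}^2(\Omega)}:=\mathbb{E}[\|Y\|^2]^{1/2}$. Densities are with respect to Lebesgue measure on $\mathbb{R}^m$. $\nabla_\lambda$ and $\mathcal{H}_\lambda$ denote the gradient and the Hessian matrix with respect to the parameter $\lambda\in\mathbb{R}^d$, $\nabla_\lambda\ln p(x|\xi)$ is the gradient evaluated at $\lambda=\xi$, and $I_d$ is the $d\times d$ identity matrix. *)

theory Defs
  imports "HOL-Probability.Probability"
begin

definition has_partial_at :: "'d \<Rightarrow> (real^'d::finite \<Rightarrow> real) \<Rightarrow> real^'d \<Rightarrow> bool" where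
  "has_partial_at i f x \<longleftrightarrow> (\<lambda>s. f (x + s *\<^sub>R axis i 1)) field_differentiable (at 0)"

text \<open>The value is meaningful only where \<^const>\<open>has_partial_at\<close> holds.\<close>

definition partial :: "'d \<Rightarrow> (real^'d::finite \<Rightarrow> real) \<Rightarrow> real^'d \<Rightarrow> real" where
  "partial i f x = deriv (\<lambda>s. f (x + s *\<^sub>R axis i 1)) 0"

definition grad :: "(real^'d::finite \<Rightarrow> real) \<Rightarrow> real^'d \<Rightarrow> real^'d" where
  "grad f x = (\<chi> i. partial i f x)"

definition hessian :: "(real^'d::finite \<Rightarrow> real) \<Rightarrow> real^'d \<Rightarrow> real^'d^'d" where
  "hessian f x = (\<chi> i j. partial i (partial j f) x)"

definition twice_cont_diff :: "(real^'d::finite \<Rightarrow> real) \<Rightarrow> bool" where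
  "twice_cont_diff f \<longleftrightarrow>
     f differentiable_on UNIV \<and> grad f differentiable_on UNIV \<and> continuous_on UNIV (hessian f)"

text \<open>Where the function is (Frechet) differentiable, \<^const>\<open>grad\<close> is the gradient of
  the library and \<^const>\<open>has_partial_at\<close> holds.\<close>

lemma GDERIV_imp_partial:
  fixes f :: "real^'d::finite \<Rightarrow> real"
  assumes "GDERIV f x :> D"
  shows "((\<lambda>s. f (x + s *\<^sub>R axis i 1)) has_field_derivative D $ i) (at 0)"
proof -
  have f: "(f has_derivative (\<lambda>h. h \<bullet> D)) (at (x + 0 *\<^sub>R axis i 1))"
    using assms by (simp add: gderiv_def)
  have "((\<lambda>s. x + s *\<^sub>R axis i 1) has_derivative (\<lambda>s. s *\<^sub>R axis i (1::real))) (at 0)"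
    by (auto intro!: derivative_eq_intros)
  from diff_chain_at[OF this f] have
    "((\<lambda>s. f (x + s *\<^sub>R axis i 1)) has_derivative (\<lambda>s. (s *\<^sub>R axis i 1) \<bullet> D)) (at 0)"
    by (simp add: o_def)
  moreover have "(\<lambda>s. (s *\<^sub>R axis i 1) \<bullet> D) = (*) (D $ i)"
    by (auto simp: fun_eq_iff inner_axis' mult.commute)
  ultimately show ?thesis
    by (simp add: has_field_derivative_def)
qed

lemma GDERIV_imp_grad:
  assumes "GDERIV f x :> D"
  shows "has_partial_at i f x" "grad f x = D"
  using GDERIV_imp_partial[OF assms]
  by (auto simp: has_partial_at_def field_differentiable_def grad_def partial_def vec_eq_iff
      intro: DERIV_imp_deriv)

text \<open>Symmetry is not demanded: it is automatic for the Hessian of a twice continuously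
  differentiable function.\<close>

definition pos_semidef :: "real^'d^'d::finite \<Rightarrow> bool" where
  "pos_semidef A \<longleftrightarrow> (\<forall>v. 0 \<le> v \<bullet> (A *v v))"

definition prob_density :: "('a::euclidean_space \<Rightarrow> real) \<Rightarrow> bool" where
  "prob_density f \<longleftrightarrow>
     f \<in> borel_measurable borel \<and> (\<forall>x. 0 \<le> f x) \<and> (\<integral>\<^sup>+x. ennreal (f x) \<partial>lborel) = 1"

text \<open>The Bochner integral of a non-integrable function is 0 by convention, so the norm of a
  random vector that is not square integrable has to be set to \<open>\<infinity>\<close> explicitly.\<close>

definition L2_norm :: "'w measure \<Rightarrow> ('w \<Rightarrow> 'a::euclidean_space) \<Rightarrow> ereal" where
  "L2_norm M Y =
     (if Y \<in> borel_measurable M \<and> integrable M (\<lambda>\<omega>. (norm (Y \<omega>))\<^sup>2)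
      then ereal (sqrt (\<integral>\<omega>. (norm (Y \<omega>))\<^sup>2 \<partial>M)) else \<infinity>)"

text \<open>Time starts at 1, so \<open>iterate p X \<alpha> \<theta>\<^sub>1 1 \<omega> = \<theta>\<^sub>1\<close>; the value at time 0 is a dummy.
  The density \<open>p(x|\<theta>)\<close> is written \<open>p x \<theta>\<close>.\<close>

primrec iterate :: "('x \<Rightarrow> real^'d::finite \<Rightarrow> real) \<Rightarrow> (nat \<Rightarrow> 'w \<Rightarrow> 'x) \<Rightarrow> real \<Rightarrow> real^'d
    \<Rightarrow> nat \<Rightarrow> 'w \<Rightarrow> real^'d" where
  "iterate p X \<alpha> \<theta>\<^sub>1 0 \<omega> = \<theta>\<^sub>1"
| "iterate p X \<alpha> \<theta>\<^sub>1 (Suc t) \<omega> =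
     (if t = 0 then \<theta>\<^sub>1
      else iterate p X \<alpha> \<theta>\<^sub>1 t \<omega> + \<alpha> *\<^sub>R grad (\<lambda>\<theta>. ln (p (X t \<omega>) \<theta>)) (iterate p X \<alpha> \<theta>\<^sub>1 t \<omega>))"

definition contraction_factor :: "real \<Rightarrow> real \<Rightarrow> real" where
  "contraction_factor \<alpha> L = sqrt (1 - 2 * L * \<alpha> + 2 * L\<^sup>2 * \<alpha>\<^sup>2)"

definition tracking_bound :: "nat \<Rightarrow> real \<Rightarrow> real \<Rightarrow> real \<Rightarrow> real" where
  "tracking_bound d L K \<alpha> =
     (contraction_factor \<alpha> L * K + \<alpha> * sqrt (2 * real d * L)) / (1 - contraction_factor \<alpha> L)"

end

theory Submission
  imports Defs
begin

text \<open>The iteration is gradient descent on the strongly convex functions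
  \<open>f x \<theta> = - ln (p x \<theta>)\<close>, where both the data and the target move. The error after a step
  splits into three contributions.

  The first is a contraction of the displacement \<open>a\<close> from the target. Strong convexity and
  the Lipschitz gradient combine into Nesterov's interpolation inequality
  (\<open>gradient_interpolation\<close>). For \<open>\<alpha> \<ge> 1 / (l + L)\<close> it yields the one-step
  estimate of \<open>contraction_step\<close>: the squared error is at most
  \<open>\<phi>\<^sup>2 |a|\<^sup>2 - 2 \<alpha> (a \<bullet> u) + 2 \<alpha>\<^sup>2 |u|\<^sup>2\<close>, where \<open>\<phi>\<close> is the contraction factor
  and \<open>u\<close> is the gradient of \<open>f\<close> at the target, that is, minus the score.

  The second is the noise. Every \<open>p(.|\<theta> + h)\<close> integrates to 1, and the quadratic upper bound
  for \<open>f\<close> compares it with \<open>p(.|\<theta>)\<close>. Hence the score at the true parameter is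
  sub-Gaussian: the mean of \<open>exp (h \<bullet> score)\<close> is at most \<open>exp (L |h|\<^sup>2 / 2)\<close>. This gives
  mean zero and second moment at most \<open>d L\<close> (\<open>score_moments\<close>). The current iterate is a
  function of earlier observations, hence independent of the current one, so the cross term has
  mean zero.

  The third is the drift of the target, which adds at most \<open>K\<close> to the \<open>L\<^sup>2\<close> error
  (\<open>L2_translate\<close>). Altogether the errors satisfy
  \<open>r (t + 1) \<le> \<phi> (r t + K) + \<alpha> sqrt (2 d L)\<close> with \<open>\<phi> < 1\<close>, and the limsup is at
  most the fixed point of this affine map (\<open>affine_recursion_limsup\<close>).

  The bound is smallest at the left end of the step range because \<open>l \<le> L\<close> gives
  \<open>1 / (l + L) \<ge> 1 / (2 L)\<close>, and from there on the contraction factor is increasing (\<open>tracking_bound_mono\<close>).\<close>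

section \<open>Gradients and second derivatives\<close>

text \<open>The Riesz representative of the derivative, here the adjoint applied to 1, has the partial
  derivatives as its coordinates.\<close>

lemma GDERIV_grad:
  fixes f :: "real^'d::finite \<Rightarrow> real"
  assumes "f differentiable (at x)"
  shows "GDERIV f x :> grad f x"
proof -
  obtain f' where f': "(f has_derivative f') (at x)"
    using assms by (auto simp: differentiable_def)
  have "h \<bullet> adjoint f' 1 = f' h" for h
    using adjoint_works[OF has_derivative_linear[OF f'], of h 1] by simp
  with f' have "GDERIV f x :> adjoint f' 1"
    by (simp add: gderiv_def)
  with GDERIV_imp_grad(2)[OF this] show ?thesis by simp
qed

lemma twice_cont_diffD:
  assumes "twice_cont_diff f"
  shows "f differentiable (at z)" "grad f differentiable (at z)"
  using assms by (auto simp: twice_cont_diff_def differentiable_on_def)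

lemma grad_uminus:
  assumes "\<And>z. f differentiable (at z)"
  shows "grad (\<lambda>z. - f z) = (\<lambda>z. - grad f z)"
  using GDERIV_imp_grad(2)[OF GDERIV_minus[OF GDERIV_grad[OF assms]]] by (rule ext)

lemma GDERIV_along_line:
  assumes "GDERIV f (x + s *\<^sub>R a) :> D"
  shows "((\<lambda>s. f (x + s *\<^sub>R a)) has_real_derivative a \<bullet> D) (at s)"
proof -
  have "((\<lambda>s. x + s *\<^sub>R a) has_derivative (\<lambda>h. h *\<^sub>R a)) (at s)"
    by (auto intro!: derivative_eq_intros)
  from diff_chain_at[OF this assms[unfolded gderiv_def]]
  show ?thesis
    by (simp add: o_def has_field_derivative_def mult.commute[of _ "a \<bullet> D"] fun_eq_iff)
qed

text \<open>Along the segment from \<open>x\<close> to \<open>y\<close> the slope of the gradient in the direction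
  \<open>y - x\<close> is the quadratic form of the Hessian, so subtracting the linear lower bound
  leaves a nondecreasing function of the line parameter.\<close>

lemma monotone_gradient_of_hessian_ge:
  fixes f :: "real^'d::finite \<Rightarrow> real"
  assumes diff: "\<And>z. grad f differentiable (at z)"
    and psd: "\<And>z. pos_semidef (hessian f z - l *\<^sub>R mat 1)"
  shows "l * (norm (y - x))\<^sup>2 \<le> (grad f y - grad f x) \<bullet> (y - x)"
proof -
  define a where "a = y - x"
  have Dj: "GDERIV (partial j f) z :> grad (partial j f) z" for j z
  proof -
    obtain G where "(grad f has_derivative G) (at z)"
      using diff[of z] by (auto simp: differentiable_def)
    from bounded_linear.has_derivative[OF bounded_linear_vec_nth[of j] this]
    have "(\<lambda>z. grad f z $ j) differentiable (at z)"
      by (auto simp: differentiable_def)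
    then show ?thesis by (intro GDERIV_grad) (simp add: grad_def)
  qed
  define \<psi> where "\<psi> s = (\<Sum>j\<in>UNIV. a $ j * partial j f (x + s *\<^sub>R a)) - s * (l * (norm a)\<^sup>2)" for s
  define \<psi>' where "\<psi>' s = (\<Sum>j\<in>UNIV. a $ j * (a \<bullet> grad (partial j f) (x + s *\<^sub>R a))) - l * (norm a)\<^sup>2" for s
  have "(\<psi> has_real_derivative \<psi>' s) (at s)" for s
    unfolding \<psi>_def \<psi>'_def
    by (auto intro!: derivative_eq_intros GDERIV_along_line Dj simp: mult.commute)
  moreover have "0 \<le> \<psi>' s" for s
  proof -
    let ?H = "hessian f (x + s *\<^sub>R a)"
    have "0 \<le> a \<bullet> ((?H - l *\<^sub>R mat 1) *v a)"
      using psd by (simp add: pos_semidef_def)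
    also have "\<dots> = a \<bullet> (?H *v a) - l * (norm a)\<^sup>2"
      by (simp add: matrix_vector_mult_diff_rdistrib inner_diff_right power2_norm_eq_inner
          scaleR_matrix_vector_assoc[symmetric])
    also have "a \<bullet> (?H *v a) = (\<Sum>j\<in>UNIV. a $ j * (a \<bullet> grad (partial j f) (x + s *\<^sub>R a)))"
    proof -
      have "a \<bullet> (?H *v a) = (\<Sum>i\<in>UNIV. \<Sum>j\<in>UNIV. a $ i * (?H $ i $ j * a $ j))"
        by (simp add: inner_vec_def matrix_vector_mult_def sum_distrib_left)
      also have "\<dots> = (\<Sum>j\<in>UNIV. \<Sum>i\<in>UNIV. a $ i * (?H $ i $ j * a $ j))"
        by (rule sum.swap)
      also have "\<dots> = (\<Sum>j\<in>UNIV. a $ j * (a \<bullet> grad (partial j f) (x + s *\<^sub>R a)))"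
        by (simp add: inner_vec_def hessian_def grad_def sum_distrib_left mult_ac)
      finally show ?thesis .
    qed
    finally show ?thesis by (simp add: \<psi>'_def)
  qed
  ultimately have "\<psi> 0 \<le> \<psi> 1"
    by (intro DERIV_nonneg_imp_nondecreasing[of 0 1 \<psi>]) auto
  then show ?thesis
    by (simp add: \<psi>_def a_def inner_vec_def grad_def sum_subtractf sum.distrib algebra_simps)
qed

lemma strongly_monotone_score:
  assumes smooth: "twice_cont_diff F"
    and strong_convex: "\<And>\<theta>. pos_semidef (hessian (\<lambda>\<theta>. - F \<theta>) \<theta> - l *\<^sub>R mat 1)"
  shows "l * (norm (y - z))\<^sup>2 \<le> (- grad F y - - grad F z) \<bullet> (y - z)"
proof -
  have neg: "grad (\<lambda>\<theta>. - F \<theta>) = (\<lambda>\<theta>. - grad F \<theta>)"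
    by (rule grad_uminus) (rule twice_cont_diffD[OF smooth])
  have "grad (\<lambda>\<theta>. - F \<theta>) differentiable (at w)" for w
    unfolding neg using twice_cont_diffD(2)[OF smooth] by (rule differentiable_minus)
  from monotone_gradient_of_hessian_ge[OF this strong_convex] show ?thesis
    by (simp only: neg)
qed

section \<open>Strongly convex functions with Lipschitz gradient\<close>

lemma inner_le_of_norm_le:
  fixes v w :: "'a::real_inner"
  assumes "norm v \<le> L * norm w"
  shows "v \<bullet> w \<le> L * (norm w)\<^sup>2"
proof -
  have "v \<bullet> w \<le> norm v * norm w" by (rule norm_cauchy_schwarz)
  also have "\<dots> \<le> L * norm w * norm w" using assms by (intro mult_right_mono) auto
  finally show ?thesis by (simp add: power2_eq_square mult.assoc)
qed

text \<open>The difference of the two sides along the segment from \<open>x\<close> to \<open>y\<close> is monotone in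
  the line parameter. The constant \<open>c\<close> may be negative: applied to \<open>- f\<close> with
  \<open>c = - l\<close>, the lemma is the lower quadratic bound of a strongly convex function.\<close>

lemma quadratic_upper_bound:
  fixes f :: "'a::real_inner \<Rightarrow> real"
  assumes grad: "\<And>z. GDERIV f z :> g z"
    and slope: "\<And>y z. (g y - g z) \<bullet> (y - z) \<le> c * (norm (y - z))\<^sup>2"
  shows "f y \<le> f x + g x \<bullet> (y - x) + c / 2 * (norm (y - x))\<^sup>2"
proof -
  define a where "a = y - x"
  define \<psi> where "\<psi> s = f (x + s *\<^sub>R a) - s * (g x \<bullet> a) - c / 2 * s\<^sup>2 * (norm a)\<^sup>2" for s
  have "(\<psi> has_real_derivative a \<bullet> g (x + s *\<^sub>R a) - g x \<bullet> a - c * s * (norm a)\<^sup>2) (at s)" for s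
    unfolding \<psi>_def
    by (auto intro!: derivative_eq_intros GDERIV_along_line grad)
  moreover have "a \<bullet> g (x + s *\<^sub>R a) - g x \<bullet> a - c * s * (norm a)\<^sup>2 \<le> 0" if "0 \<le> s" for s
  proof (cases "s = 0")
    case False
    with that have "s > 0" by simp
    have "s * ((g (x + s *\<^sub>R a) - g x) \<bullet> a) \<le> s * (c * s * (norm a)\<^sup>2)"
      using slope[of "x + s *\<^sub>R a" x] by (simp add: power_mult_distrib power2_eq_square mult_ac)
    with \<open>s > 0\<close> have "(g (x + s *\<^sub>R a) - g x) \<bullet> a \<le> c * s * (norm a)\<^sup>2"
      by (simp only: mult_le_cancel_left_pos)
    then show ?thesis by (simp add: inner_diff_left inner_diff_right inner_commute)
  qed (simp add: inner_commute)
  ultimately have "\<psi> 1 \<le> \<psi> 0"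
    by (intro DERIV_nonpos_imp_nonincreasing[of 0 1 \<psi>]) (auto, metis diff_le_0_iff_le)
  then show ?thesis by (simp add: \<psi>_def a_def inner_commute)
qed

text \<open>Nesterov's inequality for strongly convex functions with Lipschitz gradient. Writing \<open>D\<close>
  for the gradient increment and \<open>a = y - x\<close>, it says
  \<open>0 \<le> (D - l a) \<bullet> (L a - D)\<close>, which for a quadratic function expresses that the
  eigenvalues of its Hessian lie between \<open>l\<close> and \<open>L\<close>. In general it is the
  cocoercivity of the gradient of \<open>f - l/2 |.|\<^sup>2\<close>: a function lies above its quadratic
  minorant at one end of the segment and below its quadratic majorant at the other, so the
  minorant at \<open>x\<close> is below the majorant at \<open>y\<close>, at every point; the same holds with
  \<open>x\<close> and \<open>y\<close> exchanged, and the two comparisons are added at well chosen points.\<close>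

lemma gradient_interpolation:
  fixes f :: "'a::real_inner \<Rightarrow> real"
  assumes grad: "\<And>z. GDERIV f z :> g z"
    and convex: "\<And>y z. l * (norm (y - z))\<^sup>2 \<le> (g y - g z) \<bullet> (y - z)"
    and Lipschitz: "\<And>y z. norm (g y - g z) \<le> L * norm (y - z)"
    and "0 \<le> l" "l \<le> L"
  shows "l * L * (norm (y - x))\<^sup>2 + (norm (g y - g x))\<^sup>2 \<le> (l + L) * ((g y - g x) \<bullet> (y - x))"
proof (cases "l = L")
  case True
  \<comment> \<open>The cocoercivity constant \<open>1 / (L - l)\<close> degenerates, but then both bounds on the increment
    already suffice.\<close>
  have "(norm (g y - g x))\<^sup>2 \<le> L\<^sup>2 * (norm (y - x))\<^sup>2"
    using power_mono[OF Lipschitz[of y x], of 2] by (simp add: power_mult_distrib)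
  moreover have "L * (L * (norm (y - x))\<^sup>2) \<le> L * ((g y - g x) \<bullet> (y - x))"
    using convex[of y x] assms(4,5) True by (intro mult_left_mono) auto
  ultimately show ?thesis using True by (simp add: power2_eq_square algebra_simps)
next
  case False
  define \<beta> where "\<beta> = L - l"
  have "\<beta> > 0" using False assms(5) by (simp add: \<beta>_def)
  have upper: "f z \<le> f w + g w \<bullet> (z - w) + L / 2 * (norm (z - w))\<^sup>2" for z w
    by (rule quadratic_upper_bound[OF grad]) (rule inner_le_of_norm_le[OF Lipschitz])
  have lower: "f w + g w \<bullet> (z - w) + l / 2 * (norm (z - w))\<^sup>2 \<le> f z" for z w
  proof -
    have "- f z \<le> - f w + (- g w) \<bullet> (z - w) + (- l) / 2 * (norm (z - w))\<^sup>2"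
    proof (rule quadratic_upper_bound)
      show "GDERIV (\<lambda>z. - f z) z :> - g z" for z by (rule GDERIV_minus[OF grad])
      show "(- g y - - g z) \<bullet> (y - z) \<le> - l * (norm (y - z))\<^sup>2" for y z
        using convex[of y z] by (simp add: inner_diff_left)
    qed
    then show ?thesis by (simp add: inner_diff_left)
  qed
  define E where "E = (g y - g x) - l *\<^sub>R (y - x)"
  \<comment> \<open>The minimiser over \<open>z\<close> of majorant at \<open>y\<close> minus minorant at \<open>x\<close>; \<open>w\<close> is its mirror image.\<close>
  define z where "z = y - (1/\<beta>) *\<^sub>R E"
  define w where "w = x + (1/\<beta>) *\<^sub>R E"
  have 1: "f x + g x \<bullet> (z - x) + l / 2 * (norm (z - x))\<^sup>2
      \<le> f y + g y \<bullet> (z - y) + L / 2 * (norm (z - y))\<^sup>2"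
    using lower[of x z] upper[of z y] by linarith
  have 2: "f y + g y \<bullet> (w - y) + l / 2 * (norm (w - y))\<^sup>2
      \<le> f x + g x \<bullet> (w - x) + L / 2 * (norm (w - x))\<^sup>2"
    using lower[of y w] upper[of w x] by linarith
  define a where "a = y - x"
  define e where "e = (1/\<beta>) *\<^sub>R E"
  have E\<beta>: "g y - g x = l *\<^sub>R a + \<beta> *\<^sub>R e"
    using \<open>\<beta> > 0\<close> by (simp add: E_def e_def a_def)
  have gy: "g y = g x + l *\<^sub>R a + \<beta> *\<^sub>R e" using E\<beta> by (simp add: algebra_simps)
  have zs: "z - x = a - e" "z - y = - e" "w - y = e - a" "w - x = e"
    by (simp_all add: z_def w_def a_def e_def)
  have "\<beta> * (e \<bullet> e) \<le> \<beta> * (e \<bullet> a)"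
    using add_mono[OF 1 2] unfolding zs gy power2_norm_eq_inner
    unfolding \<beta>_def by (simp add: inner_simps inner_commute[of a e]) (simp add: algebra_simps)
  then have "\<beta> * (\<beta> * (e \<bullet> e)) \<le> \<beta> * (\<beta> * (e \<bullet> a))" 
    using \<open>\<beta> > 0\<close> by simp
  then show ?thesis
    unfolding E\<beta> a_def[symmetric] power2_norm_eq_inner
    unfolding \<beta>_def by (simp add: inner_simps inner_commute[of a e]) (simp add: algebra_simps)
qed

text \<open>Both bounds are compared on a unit vector, which exists because a Euclidean space has positive
  dimension.\<close>

lemma convexity_modulus_le_Lipschitz:
  fixes g :: "'a::euclidean_space \<Rightarrow> 'a"
  assumes convex: "\<And>y z. l * (norm (y - z))\<^sup>2 \<le> (g y - g z) \<bullet> (y - z)"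
    and Lipschitz: "\<And>y z. norm (g y - g z) \<le> L * norm (y - z)"
  shows "l \<le> L"
proof -
  obtain b :: 'a where "b \<in> Basis" using nonempty_Basis by blast
  then have "norm b = 1" by simp
  with convex[of b 0] inner_le_of_norm_le[OF Lipschitz[of b 0]] show ?thesis by simp
qed

text \<open>One gradient step from the displacement \<open>a\<close> of the iterate, where the gradient splits
  into its value \<open>u\<close> at the target and the increment \<open>D\<close>. The inequality
  \<open>|D + u|\<^sup>2 \<le> 2 |D|\<^sup>2 + 2 |u|\<^sup>2\<close> separates noise from signal, and for the
  signal one needs
  \<open>\<alpha> |D|\<^sup>2 + L (1 - \<alpha> L) |a|\<^sup>2 \<le> D \<bullet> a\<close>. After multiplication by
  \<open>l + L\<close> this is the interpolation inequality plus the nonnegative quantity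
  \<open>(\<alpha> (l + L) - 1) (L\<^sup>2 |a|\<^sup>2 - |D|\<^sup>2)\<close>; this is where
  \<open>\<alpha> \<ge> 1 / (l + L)\<close> enters, and it makes the upper end \<open>L\<close> of the spectrum the
  worst case. The cross term with \<open>u\<close> is kept, since its mean vanishes.\<close>

lemma contraction_step:
  fixes a D u :: "'a::real_inner"
  assumes interp: "l * L * (norm a)\<^sup>2 + (norm D)\<^sup>2 \<le> (l + L) * (D \<bullet> a)"
    and Lip: "norm D \<le> L * norm a"
    and "0 < l" "0 < L" "1 / (l + L) \<le> \<alpha>"
  shows "(norm (a - \<alpha> *\<^sub>R (D + u)))\<^sup>2
    \<le> (contraction_factor \<alpha> L)\<^sup>2 * (norm a)\<^sup>2 - 2 * \<alpha> * (a \<bullet> u) + 2 * \<alpha>\<^sup>2 * (norm u)\<^sup>2"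
proof -
  have \<alpha>: "0 < \<alpha>" "1 \<le> \<alpha> * (l + L)"
    using assms(3-5) by (auto simp: divide_simps mult.commute intro: less_le_trans[of 0 "1 / (l+L)"] split: if_splits)
  have pos: "0 \<le> 1 - 2 * L * \<alpha> + 2 * L\<^sup>2 * \<alpha>\<^sup>2"
  proof -
    have "1 - 2 * L * \<alpha> + 2 * L\<^sup>2 * \<alpha>\<^sup>2 = (1 - L * \<alpha>)\<^sup>2 + (L * \<alpha>)\<^sup>2"
      by (simp add: power2_eq_square algebra_simps)
    then show ?thesis by simp
  qed
  have phi: "(contraction_factor \<alpha> L)\<^sup>2 = 1 - 2 * L * \<alpha> + 2 * L\<^sup>2 * \<alpha>\<^sup>2"
    using pos by (simp add: contraction_factor_def)
  have D2: "(norm D)\<^sup>2 \<le> L\<^sup>2 * (norm a)\<^sup>2"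
    using power_mono[OF Lip, of 2] by (simp add: power_mult_distrib)
  have "0 \<le> (\<alpha> * (l + L) - 1) * (L\<^sup>2 * (norm a)\<^sup>2 - (norm D)\<^sup>2)"
    using \<alpha> D2 by simp
  then have "(l + L) * (L * (1 - \<alpha> * L) * (norm a)\<^sup>2 + \<alpha> * (norm D)\<^sup>2) \<le> (l + L) * (D \<bullet> a)"
    using interp by (simp add: power2_eq_square algebra_simps)
  then have "L * (1 - \<alpha> * L) * (norm a)\<^sup>2 + \<alpha> * (norm D)\<^sup>2 \<le> D \<bullet> a"
    using assms(3,4) by simp
  then have key: "2 * \<alpha> * (L * (1 - \<alpha> * L) * (norm a)\<^sup>2 + \<alpha> * (norm D)\<^sup>2) \<le> 2 * \<alpha> * (D \<bullet> a)"
    using \<alpha> by simp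
  \<comment> \<open>Parallelogram law: this is what bounds \<open>|D + u|\<^sup>2\<close>.\<close>
  have "0 \<le> \<alpha>\<^sup>2 * (norm (D - u))\<^sup>2" by simp
  then show ?thesis
    using key unfolding phi power2_norm_eq_inner
    by (simp add: inner_simps inner_commute) (simp add: algebra_simps power2_eq_square)
qed

section \<open>The score at the true parameter\<close>

text \<open>A Gaussian bound on the moment generating function touches it at \<open>s = 0\<close>. The bound minus
  its linear minorant \<open>1 + s E u\<close> therefore has a minimum at 0, which forces
  \<open>E u = 0\<close>. Averaging the bounds at \<open>s\<close> and \<open>- s\<close> and using
  \<open>1 + y\<^sup>2 / 2 \<le> cosh y\<close> bounds the second moment by a quotient that tends to
  \<open>c\<close> as \<open>s\<close> tends to 0.\<close>

lemma subgaussian_moments: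
  fixes u :: "'w \<Rightarrow> real"
  assumes "prob_space M" and u[measurable]: "u \<in> borel_measurable M"
    and mgf: "\<And>s. (\<integral>\<^sup>+\<omega>. ennreal (exp (s * u \<omega>)) \<partial>M) \<le> ennreal (exp (c * s\<^sup>2 / 2))"
  shows "integrable M u" "(\<integral>\<omega>. u \<omega> \<partial>M) = 0"
    "integrable M (\<lambda>\<omega>. (u \<omega>)\<^sup>2)" "(\<integral>\<omega>. (u \<omega>)\<^sup>2 \<partial>M) \<le> c"
proof -
  interpret prob_space M by fact
  have int_exp: "integrable M (\<lambda>\<omega>. exp (s * u \<omega>))" for s
    using mgf[of s] by (intro integrableI_nonneg) (auto simp: le_less_trans top.not_eq_extremum)
  have exp_le: "(\<integral>\<omega>. exp (s * u \<omega>) \<partial>M) \<le> exp (c * s\<^sup>2 / 2)" for s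
    using mgf[of s] by (subst (asm) nn_integral_eq_integral[OF int_exp]) auto
  have cosh_ge: "1 + y\<^sup>2 / 2 \<le> (exp y + exp (- y)) / 2" for y :: real
  proof -
    \<comment> \<open>The remainder of even order 4 is nonnegative; the odd terms cancel when \<open>y\<close> and \<open>- y\<close> are averaged.\<close>
    have "1 + z + z\<^sup>2 / 2 + z ^ 3 / 6 \<le> exp z" for z :: real
    proof -
      obtain t where "exp z = (\<Sum>m<4. z ^ m / fact m) + exp t / fact 4 * z ^ 4"
        using Maclaurin_exp_le[of z 4] by blast
      moreover have "0 \<le> exp t / fact 4 * z ^ 4" by simp
      ultimately show ?thesis by (simp add: eval_nat_numeral)
    qed
    from this[of y] this[of "- y"] show ?thesis by simp
  qed
  show "integrable M u"
  proof (rule Bochner_Integration.integrable_bound)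
    show "integrable M (\<lambda>\<omega>. exp (1 * u \<omega>) + exp (- 1 * u \<omega>))"
      by (intro Bochner_Integration.integrable_add int_exp)
    show "AE \<omega> in M. norm (u \<omega>) \<le> norm (exp (1 * u \<omega>) + exp (- 1 * u \<omega>))"
    proof (rule AE_I2)
      fix \<omega>
      have "\<bar>u \<omega>\<bar> \<le> exp (u \<omega>) + exp (- u \<omega>)"
        using exp_ge_add_one_self[of "u \<omega>"] exp_ge_add_one_self[of "- u \<omega>"]
          exp_gt_zero[of "u \<omega>"] exp_gt_zero[of "- u \<omega>"] by linarith
      then show "norm (u \<omega>) \<le> norm (exp (1 * u \<omega>) + exp (- 1 * u \<omega>))" by simp
    qed
  qed simp
  note int_u = this
  show int_u2: "integrable M (\<lambda>\<omega>. (u \<omega>)\<^sup>2)"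
  proof (rule Bochner_Integration.integrable_bound)
    show "integrable M (\<lambda>\<omega>. exp (1 * u \<omega>) + exp (- 1 * u \<omega>))"
      by (intro Bochner_Integration.integrable_add int_exp)
    show "AE \<omega> in M. norm ((u \<omega>)\<^sup>2) \<le> norm (exp (1 * u \<omega>) + exp (- 1 * u \<omega>))"
    proof (rule AE_I2)
      fix \<omega>
      show "norm ((u \<omega>)\<^sup>2) \<le> norm (exp (1 * u \<omega>) + exp (- 1 * u \<omega>))"
        using cosh_ge[of "u \<omega>"] by simp
    qed
  qed simp
  define m where "m = (\<integral>\<omega>. u \<omega> \<partial>M)"
  have m: "1 + s * m \<le> exp (c * s\<^sup>2 / 2)" for s
  proof -
    have "1 + s * m = (\<integral>\<omega>. 1 + s * u \<omega> \<partial>M)"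
      using int_u by (simp add: m_def prob_space)
    also have "\<dots> \<le> (\<integral>\<omega>. exp (s * u \<omega>) \<partial>M)"
      using int_u int_exp by (intro integral_mono) auto
    finally show ?thesis using exp_le[of s] by linarith
  qed
  have "((\<lambda>s. exp (c * s\<^sup>2 / 2) - 1 - s * m) has_real_derivative - m) (at 0)"
    by (auto intro!: derivative_eq_intros)
  from DERIV_local_min[OF this zero_less_one] m show "(\<integral>\<omega>. u \<omega> \<partial>M) = 0"
    by (simp add: m_def algebra_simps)
  define v where "v = (\<integral>\<omega>. (u \<omega>)\<^sup>2 \<partial>M)"
  have v: "1 + s\<^sup>2 / 2 * v \<le> exp (c * s\<^sup>2 / 2)" for s
  proof -
    have "1 + s\<^sup>2 / 2 * v = (\<integral>\<omega>. 1 + (s * u \<omega>)\<^sup>2 / 2 \<partial>M)"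
      using int_u2 by (simp add: v_def prob_space power_mult_distrib)
    also have "\<dots> \<le> (\<integral>\<omega>. (exp (s * u \<omega>) + exp (- s * u \<omega>)) / 2 \<partial>M)"
    proof (rule integral_mono)
      show "integrable M (\<lambda>\<omega>. 1 + (s * u \<omega>)\<^sup>2 / 2)"
        using int_u2 by (simp add: power_mult_distrib)
      show "integrable M (\<lambda>\<omega>. (exp (s * u \<omega>) + exp (- s * u \<omega>)) / 2)"
        using int_exp[of s] int_exp[of "- s"] by simp
      show "1 + (s * u \<omega>)\<^sup>2 / 2 \<le> (exp (s * u \<omega>) + exp (- s * u \<omega>)) / 2" for \<omega>
        using cosh_ge[of "s * u \<omega>"] by simp
    qed
    also have "\<dots> \<le> exp (c * s\<^sup>2 / 2)"
      using int_exp[of s] int_exp[of "- s"] exp_le[of s] exp_le[of "- s"] by simp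
    finally show ?thesis .
  qed
  \<comment> \<open>With \<open>y = s\<^sup>2 / 2\<close> the bound becomes a difference quotient of \<open>exp (c y)\<close> at 0.\<close>
  have v': "v \<le> (exp (c * y) - 1) / y" if "y > 0" for y
    using v[of "sqrt (2 * y)"] that by (simp add: field_simps)
  have "((\<lambda>y. exp (c * y)) has_real_derivative c) (at 0)"
    by (auto intro!: derivative_eq_intros)
  then have "((\<lambda>y. (exp (c * y) - 1) / y) \<longlongrightarrow> c) (at_right 0)"
    by (auto simp: DERIV_def intro: filterlim_mono[OF _ order_refl at_le])
  then show "(\<integral>\<omega>. (u \<omega>)\<^sup>2 \<partial>M) \<le> c"
    unfolding v_def[symmetric]
    by (rule tendsto_lowerbound) (auto simp: eventually_at_filter v' intro!: always_eventually)
qed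

text \<open>The Lipschitz gradient gives
  \<open>p x \<theta> exp (h \<bullet> S) \<le> exp (L |h|\<^sup>2 / 2) p x (\<theta> + h)\<close> for the score \<open>S\<close> at
  \<open>\<theta>\<close>, and the density at the shifted parameter still has integral 1. In this way the
  score is controlled without differentiating under the integral sign.\<close>

lemma score_moment_generating_function:
  fixes p :: "'x::euclidean_space \<Rightarrow> real^'d::finite \<Rightarrow> real"
  assumes density: "\<And>\<theta>. prob_density (\<lambda>x. p x \<theta>)"
    and density_pos: "\<And>x \<theta>. p x \<theta> > 0"
    and diff: "\<And>x \<theta>. (\<lambda>\<theta>. ln (p x \<theta>)) differentiable (at \<theta>)"
    and lipschitz_grad: "\<And>x \<xi>\<^sub>1 \<xi>\<^sub>2.
        norm (grad (\<lambda>\<theta>. ln (p x \<theta>)) \<xi>\<^sub>1 - grad (\<lambda>\<theta>. ln (p x \<theta>)) \<xi>\<^sub>2) \<le> L * norm (\<xi>\<^sub>1 - \<xi>\<^sub>2)"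
  shows "(\<integral>\<^sup>+x. ennreal (p x \<theta>) * ennreal (exp (h \<bullet> grad (\<lambda>\<theta>. ln (p x \<theta>)) \<theta>)) \<partial>lborel)
    \<le> ennreal (exp (L / 2 * (norm h)\<^sup>2))"
proof -
  have "p x \<theta> * exp (h \<bullet> grad (\<lambda>\<theta>. ln (p x \<theta>)) \<theta>) \<le> exp (L / 2 * (norm h)\<^sup>2) * p x (\<theta> + h)" for x
  proof -
    define g where "g = grad (\<lambda>\<theta>. ln (p x \<theta>))"
    have "- ln (p x (\<theta> + h)) \<le> - ln (p x \<theta>) + (- g \<theta>) \<bullet> (\<theta> + h - \<theta>) + L / 2 * (norm (\<theta> + h - \<theta>))\<^sup>2"
    proof (rule quadratic_upper_bound)
      show "GDERIV (\<lambda>\<theta>. - ln (p x \<theta>)) z :> - g z" for z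
        unfolding g_def by (rule GDERIV_minus[OF GDERIV_grad[OF diff]])
      show "(- g y - - g z) \<bullet> (y - z) \<le> L * (norm (y - z))\<^sup>2" for y z
        using lipschitz_grad[of x y z]
        by (intro inner_le_of_norm_le) (simp add: g_def norm_minus_commute)
    qed
    then have "ln (p x \<theta>) + h \<bullet> g \<theta> \<le> L / 2 * (norm h)\<^sup>2 + ln (p x (\<theta> + h))"
      by (simp add: inner_commute)
    then have "exp (ln (p x \<theta>) + h \<bullet> g \<theta>) \<le> exp (L / 2 * (norm h)\<^sup>2 + ln (p x (\<theta> + h)))"
      by simp
    then show ?thesis
      using density_pos by (simp only: exp_add exp_ln g_def)
  qed
  then have "(\<integral>\<^sup>+x. ennreal (p x \<theta>) * ennreal (exp (h \<bullet> grad (\<lambda>\<theta>. ln (p x \<theta>)) \<theta>)) \<partial>lborel)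
      \<le> (\<integral>\<^sup>+x. ennreal (exp (L / 2 * (norm h)\<^sup>2)) * ennreal (p x (\<theta> + h)) \<partial>lborel)"
    using density_pos by (intro nn_integral_mono) (simp add: ennreal_mult[symmetric] less_imp_le)
  also have "\<dots> = ennreal (exp (L / 2 * (norm h)\<^sup>2)) * (\<integral>\<^sup>+x. ennreal (p x (\<theta> + h)) \<partial>lborel)"
    using density[of "\<theta> + h"] by (intro nn_integral_cmult) (simp add: prob_density_def)
  also have "\<dots> = ennreal (exp (L / 2 * (norm h)\<^sup>2))"
    using density[of "\<theta> + h"] by (simp add: prob_density_def)
  finally show ?thesis .
qed

text \<open>Each coordinate of the score at the true parameter is sub-Gaussian with variance proxy
  \<open>L\<close>. Hence it has mean zero, and the trace of the Fisher information is at most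
  \<open>L\<close> times the dimension.\<close>

lemma score_moments:
  fixes p :: "'x::euclidean_space \<Rightarrow> real^'d::finite \<Rightarrow> real"
  assumes "prob_space M"
    and density: "\<And>\<theta>. prob_density (\<lambda>x. p x \<theta>)"
    and density_pos: "\<And>x \<theta>. p x \<theta> > 0"
    and diff: "\<And>x \<theta>. (\<lambda>\<theta>. ln (p x \<theta>)) differentiable (at \<theta>)"
    and lipschitz_grad: "\<And>x \<xi>\<^sub>1 \<xi>\<^sub>2.
        norm (grad (\<lambda>\<theta>. ln (p x \<theta>)) \<xi>\<^sub>1 - grad (\<lambda>\<theta>. ln (p x \<theta>)) \<xi>\<^sub>2) \<le> L * norm (\<xi>\<^sub>1 - \<xi>\<^sub>2)"
    and X: "distributed M lborel X (\<lambda>x. ennreal (p x \<theta>))"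
    and score_meas: "(\<lambda>x. grad (\<lambda>\<theta>. ln (p x \<theta>)) \<theta>) \<in> borel_measurable borel"
  defines "U \<equiv> \<lambda>\<omega>. grad (\<lambda>\<theta>. ln (p (X \<omega>) \<theta>)) \<theta>"
  shows "integrable M (\<lambda>\<omega>. U \<omega> $ i)" "(\<integral>\<omega>. U \<omega> $ i \<partial>M) = 0"
    "integrable M (\<lambda>\<omega>. (norm (U \<omega>))\<^sup>2)" "(\<integral>\<omega>. (norm (U \<omega>))\<^sup>2 \<partial>M) \<le> real CARD('d) * L"
proof -
  have X_meas: "X \<in> borel_measurable M"
    using distributed_measurable[OF X] by simp
  have U_meas: "U \<in> borel_measurable M"
    unfolding U_def by (rule measurable_compose[OF X_meas score_meas])
  have "(\<lambda>\<omega>. U \<omega> \<bullet> axis i 1) \<in> borel_measurable M" for i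
    using U_meas by (intro borel_measurable_inner) auto
  then have comp_meas: "(\<lambda>\<omega>. U \<omega> $ i) \<in> borel_measurable M" for i
    by (simp add: inner_axis)
  have mgf: "(\<integral>\<^sup>+\<omega>. ennreal (exp (s * U \<omega> $ i)) \<partial>M) \<le> ennreal (exp (L * s\<^sup>2 / 2))" for s i
  proof -
    define h where "h = s *\<^sub>R axis i (1::real)"
    have h: "h \<bullet> v = s * v $ i" "(norm h)\<^sup>2 = s\<^sup>2" for v
      by (simp_all add: h_def inner_axis')
    have "(\<lambda>x. ennreal (exp (h \<bullet> grad (\<lambda>\<theta>. ln (p x \<theta>)) \<theta>))) \<in> borel_measurable lborel"
      using score_meas by simp
    from distributed_nn_integral[OF X this]
      score_moment_generating_function[of p L \<theta> h, OF density density_pos diff lipschitz_grad]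
    show ?thesis by (simp add: h U_def)
  qed
  note moments = subgaussian_moments[OF \<open>prob_space M\<close> comp_meas mgf]
  show "integrable M (\<lambda>\<omega>. U \<omega> $ i)" "(\<integral>\<omega>. U \<omega> $ i \<partial>M) = 0"
    using moments by auto
  have norm_U: "(norm (U \<omega>))\<^sup>2 = (\<Sum>i\<in>UNIV. (U \<omega> $ i)\<^sup>2)" for \<omega>
    unfolding power2_norm_eq_inner inner_vec_def by (simp add: power2_eq_square)
  show "integrable M (\<lambda>\<omega>. (norm (U \<omega>))\<^sup>2)"
    unfolding norm_U using moments(3) by simp
  have "(\<integral>\<omega>. (norm (U \<omega>))\<^sup>2 \<partial>M) = (\<Sum>i\<in>UNIV. \<integral>\<omega>. (U \<omega> $ i)\<^sup>2 \<partial>M)"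
    unfolding norm_U using moments(3) by simp
  also have "\<dots> \<le> (\<Sum>i\<in>(UNIV::'d set). L)"
    by (intro sum_mono moments(4))
  finally show "(\<integral>\<omega>. (norm (U \<omega>))\<^sup>2 \<partial>M) \<le> real CARD('d) * L" by simp
qed

section \<open>Measurability and independence of the iterates\<close>

text \<open>Measurability in one variable and continuity in the other allow a random point to be
  substituted: it is a pointwise limit of simple functions, for which the substitution involves
  only finitely many values.\<close>

lemma borel_measurable_Caratheodory:
  fixes h :: "'w \<Rightarrow> 'b::{second_countable_topology, metric_space} \<Rightarrow> 'c::metric_space"
  assumes meas: "\<And>y. (\<lambda>\<omega>. h \<omega> y) \<in> borel_measurable M"
    and cont: "\<And>\<omega>. continuous_on UNIV (h \<omega>)"
    and Y: "Y \<in> borel_measurable M"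
  shows "(\<lambda>\<omega>. h \<omega> (Y \<omega>)) \<in> borel_measurable M"
proof -
  obtain F where F: "\<And>i. simple_function M (F i)"
    "\<And>\<omega>. \<omega> \<in> space M \<Longrightarrow> (\<lambda>i. F i \<omega>) \<longlonglongrightarrow> Y \<omega>"
    using borel_measurable_implies_sequence_metric[OF Y] by metis
  show ?thesis
  proof (rule borel_measurable_LIMSEQ_metric)
    fix i
    show "(\<lambda>\<omega>. h \<omega> (F i \<omega>)) \<in> borel_measurable M"
    proof (rule measurable_compose_countable'[where I="F i ` space M" and f="\<lambda>y \<omega>. h \<omega> y"])
      show "F i \<in> measurable M (count_space (F i ` space M))"
        using F(1)[of i] by (auto simp: simple_function_def measurable_count_space_eq2)
    qed (use F(1)[of i] meas in \<open>auto simp: simple_function_def countable_finite\<close>)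
  next
    fix \<omega> assume "\<omega> \<in> space M"
    from continuous_on_tendsto_compose[OF cont F(2)[OF this]]
    show "(\<lambda>i. h \<omega> (F i \<omega>)) \<longlonglongrightarrow> h \<omega> (Y \<omega>)" by simp
  qed
qed

text \<open>Partial derivatives are limits of difference quotients along the sequence \<open>1 / (n + 1)\<close>.\<close>

lemma borel_measurable_grad:
  fixes F :: "'x \<Rightarrow> real^'d::finite \<Rightarrow> real"
  assumes meas: "\<And>\<theta>. (\<lambda>x. F x \<theta>) \<in> borel_measurable N"
    and diff: "\<And>x. F x differentiable (at \<theta>)"
  shows "(\<lambda>x. grad (F x) \<theta>) \<in> borel_measurable N"
proof -
  have "(\<lambda>x. partial i (F x) \<theta>) \<in> borel_measurable N" for i
  proof (rule borel_measurable_LIMSEQ_metric)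
    show "(\<lambda>x. (F x (\<theta> + inverse (real (Suc n)) *\<^sub>R axis i 1) - F x \<theta>) / inverse (real (Suc n)))
        \<in> borel_measurable N" for n
      using meas by measurable
    fix x
    have "((\<lambda>s. F x (\<theta> + s *\<^sub>R axis i 1)) has_real_derivative partial i (F x) \<theta>) (at 0)"
      using GDERIV_imp_partial[OF GDERIV_grad[OF diff[of x]], of i] by (simp add: grad_def)
    then have "((\<lambda>s. (F x (\<theta> + s *\<^sub>R axis i 1) - F x \<theta>) / s) \<longlongrightarrow> partial i (F x) \<theta>) (at 0)"
      by (simp add: DERIV_def)
    then show "(\<lambda>n. (F x (\<theta> + inverse (real (Suc n)) *\<^sub>R axis i 1) - F x \<theta>) / inverse (real (Suc n)))
        \<longlonglongrightarrow> partial i (F x) \<theta>"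
      by (rule filterlim_compose) (intro filterlim_atI LIMSEQ_inverse_real_of_nat, simp)
  qed
  then have "(\<lambda>x. \<Sum>i\<in>UNIV. partial i (F x) \<theta> *\<^sub>R axis i (1::real)) \<in> borel_measurable N"
    by (intro borel_measurable_sum borel_measurable_scaleR) auto
  moreover have "grad (F x) \<theta> = (\<Sum>i\<in>UNIV. partial i (F x) \<theta> *\<^sub>R axis i (1::real))" for x
    by (simp add: grad_def vec_eq_iff axis_def if_distrib[of "(*) _"] cong: if_cong)
  ultimately show ?thesis by simp
qed

text \<open>The iterate at time \<open>t\<close> depends on the observations before time \<open>t\<close> only. The two
  sample points may live in different spaces, so that the iterate can also be read as a function
  on the product space of past observations.\<close>

lemma iterate_cong:
  assumes "\<And>i. 1 \<le> i \<Longrightarrow> i < t \<Longrightarrow> X i \<omega> = Y i \<omega>'"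
  shows "iterate p X \<alpha> \<theta>\<^sub>1 t \<omega> = iterate p Y \<alpha> \<theta>\<^sub>1 t \<omega>'"
  using assms
proof (induction t)
  case (Suc t)
  then have "iterate p X \<alpha> \<theta>\<^sub>1 t \<omega> = iterate p Y \<alpha> \<theta>\<^sub>1 t \<omega>'" by simp
  moreover have "X t \<omega> = Y t \<omega>'" if "t \<noteq> 0" using Suc.prems[of t] that by simp
  ultimately show ?case by (cases "t = 0") (simp_all del: One_nat_def)
qed simp

lemma borel_measurable_iterate:
  assumes score_meas: "\<And>\<theta>. (\<lambda>x. grad (\<lambda>\<theta>. ln (p x \<theta>)) \<theta>) \<in> borel_measurable S"
    and score_cont: "\<And>x. continuous_on UNIV (grad (\<lambda>\<theta>. ln (p x \<theta>)))"
    and Y: "\<And>i. 1 \<le> i \<Longrightarrow> i < t \<Longrightarrow> Y i \<in> measurable N S"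
  shows "iterate p Y \<alpha> \<theta>\<^sub>1 t \<in> borel_measurable N"
  using Y
proof (induction t)
  case 0
  have "iterate p Y \<alpha> \<theta>\<^sub>1 0 = (\<lambda>_. \<theta>\<^sub>1)" by (simp add: fun_eq_iff)
  then show ?case by simp
next
  case (Suc t)
  show ?case
  proof (cases "t = 0")
    case True
    then have "iterate p Y \<alpha> \<theta>\<^sub>1 (Suc t) = (\<lambda>_. \<theta>\<^sub>1)" by (simp add: fun_eq_iff)
    then show ?thesis by simp
  next
    case False
    have IH: "iterate p Y \<alpha> \<theta>\<^sub>1 t \<in> borel_measurable N" using Suc by auto
    have "(\<lambda>\<omega>. grad (\<lambda>\<theta>. ln (p (Y t \<omega>) \<theta>)) (iterate p Y \<alpha> \<theta>\<^sub>1 t \<omega>)) \<in> borel_measurable N"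
    proof (rule borel_measurable_Caratheodory[where h="\<lambda>\<omega>. grad (\<lambda>\<theta>. ln (p (Y t \<omega>) \<theta>))"])
      have "Y t \<in> measurable N S" using False Suc.prems by simp
      then show "(\<lambda>\<omega>. grad (\<lambda>\<theta>. ln (p (Y t \<omega>) \<theta>)) \<theta>) \<in> borel_measurable N" for \<theta>
        by (rule measurable_compose[OF _ score_meas])
    qed (rule score_cont IH)+
    with IH have "(\<lambda>\<omega>. iterate p Y \<alpha> \<theta>\<^sub>1 t \<omega> + \<alpha> *\<^sub>R grad (\<lambda>\<theta>. ln (p (Y t \<omega>) \<theta>)) (iterate p Y \<alpha> \<theta>\<^sub>1 t \<omega>))
        \<in> borel_measurable N"
      by (intro borel_measurable_add borel_measurable_scaleR) auto
    moreover have "iterate p Y \<alpha> \<theta>\<^sub>1 (Suc t) =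
       (\<lambda>\<omega>. iterate p Y \<alpha> \<theta>\<^sub>1 t \<omega> + \<alpha> *\<^sub>R grad (\<lambda>\<theta>. ln (p (Y t \<omega>) \<theta>)) (iterate p Y \<alpha> \<theta>\<^sub>1 t \<omega>))"
      using False by (simp add: fun_eq_iff)
    ultimately show ?thesis by simp
  qed
qed

text \<open>The iterate is a measurable function of the observations at times \<open>1, ..., t - 1\<close>, which
  are jointly independent of the one at time \<open>t\<close>.\<close>

lemma indep_iterate_observation:
  fixes p :: "'x::topological_space \<Rightarrow> real^'d::finite \<Rightarrow> real"
  assumes "prob_space M"
    and indep: "prob_space.indep_vars M (\<lambda>_. borel) X {1..}"
    and score_meas: "\<And>\<theta>. (\<lambda>x. grad (\<lambda>\<theta>. ln (p x \<theta>)) \<theta>) \<in> borel_measurable borel"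
    and score_cont: "\<And>x. continuous_on UNIV (grad (\<lambda>\<theta>. ln (p x \<theta>)))"
    and "1 \<le> t" "\<phi> \<in> measurable borel A" "\<psi> \<in> measurable borel B"
  shows "prob_space.indep_var M A (\<lambda>\<omega>. \<phi> (iterate p X \<alpha> \<theta>\<^sub>1 t \<omega>)) B (\<lambda>\<omega>. \<psi> (X t \<omega>))"
proof -
  interpret prob_space M by fact
  let ?past = "{1..<t}"
  let ?iter = "iterate p (\<lambda>i w. w i) \<alpha> \<theta>\<^sub>1 t"
  have *: "indep_var (PiM ?past (\<lambda>_. borel)) (\<lambda>\<omega>. restrict (\<lambda>i. X i \<omega>) ?past)
      (PiM {t} (\<lambda>_. borel)) (\<lambda>\<omega>. restrict (\<lambda>i. X i \<omega>) {t})"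
    using \<open>1 \<le> t\<close> by (intro indep_var_restrict[OF indep]) auto
  have "?iter \<in> borel_measurable (PiM ?past (\<lambda>_. borel))"
    by (rule borel_measurable_iterate[where S=borel, OF score_meas score_cont])
       (auto intro!: measurable_component_singleton)
  then have past: "(\<lambda>w. \<phi> (?iter w)) \<in> measurable (PiM ?past (\<lambda>_. borel)) A"
    by (rule measurable_compose) fact
  have "(\<lambda>w. w t) \<in> borel_measurable (PiM {t} (\<lambda>_. borel))"
    by (auto intro!: measurable_component_singleton)
  then have now: "(\<lambda>w. \<psi> (w t)) \<in> measurable (PiM {t} (\<lambda>_. borel)) B"
    by (rule measurable_compose) fact
  have "iterate p X \<alpha> \<theta>\<^sub>1 t \<omega> = ?iter (restrict (\<lambda>i. X i \<omega>) ?past)" for \<omega>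
    by (rule iterate_cong) auto
  with indep_var_compose[OF * past now] show ?thesis
    by (simp add: o_def)
qed

lemma orthogonal_in_mean:
  fixes a u :: "'w \<Rightarrow> real^'d::finite"
  assumes "prob_space M"
    and indep: "\<And>i. prob_space.indep_var M borel (\<lambda>\<omega>. a \<omega> $ i) borel (\<lambda>\<omega>. u \<omega> $ i)"
    and a: "\<And>i. integrable M (\<lambda>\<omega>. a \<omega> $ i)"
    and u: "\<And>i. integrable M (\<lambda>\<omega>. u \<omega> $ i)" "\<And>i. (\<integral>\<omega>. u \<omega> $ i \<partial>M) = 0"
  shows "integrable M (\<lambda>\<omega>. a \<omega> \<bullet> u \<omega>)" "(\<integral>\<omega>. a \<omega> \<bullet> u \<omega> \<partial>M) = 0"
proof -
  interpret prob_space M by fact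
  have int: "integrable M (\<lambda>\<omega>. a \<omega> $ i * u \<omega> $ i)" for i
    by (rule indep_var_integrable[OF indep a u(1)])
  have zero: "(\<integral>\<omega>. a \<omega> $ i * u \<omega> $ i \<partial>M) = 0" for i
    by (simp add: indep_var_lebesgue_integral[OF indep a u(1)] u(2))
  show "integrable M (\<lambda>\<omega>. a \<omega> \<bullet> u \<omega>)" using int by (simp add: inner_vec_def)
  show "(\<integral>\<omega>. a \<omega> \<bullet> u \<omega> \<partial>M) = 0" using int zero by (simp add: inner_vec_def)
qed

section \<open>Root mean square errors and affine recursions\<close>

text \<open>Minkowski's inequality for a deterministic shift. The square is expanded, and the mean of the
  norm is bounded by its root mean square because a variance is nonnegative.\<close>

lemma L2_translate:
  fixes Y :: "'w \<Rightarrow> 'a::euclidean_space"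
  assumes "prob_space M" and Y[measurable]: "Y \<in> borel_measurable M"
    and int: "integrable M (\<lambda>\<omega>. (norm (Y \<omega>))\<^sup>2)"
    and c: "norm c \<le> K"
  shows "integrable M (\<lambda>\<omega>. (norm (Y \<omega> - c))\<^sup>2)"
    "sqrt (\<integral>\<omega>. (norm (Y \<omega> - c))\<^sup>2 \<partial>M) \<le> sqrt (\<integral>\<omega>. (norm (Y \<omega>))\<^sup>2 \<partial>M) + K"
proof -
  interpret prob_space M by fact
  have "0 \<le> K" using c norm_ge_zero order_trans by blast
  have int1: "integrable M (\<lambda>\<omega>. norm (Y \<omega>))"
    by (rule square_integrable_imp_integrable[OF _ int]) simp
  have pointwise: "(norm (Y \<omega> - c))\<^sup>2 \<le> (norm (Y \<omega>) + K)\<^sup>2" for \<omega>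
    using c norm_triangle_ineq4[of "Y \<omega>" c] by (intro power_mono) auto
  have expand: "(norm (Y \<omega>) + K)\<^sup>2 = (norm (Y \<omega>))\<^sup>2 + 2 * K * norm (Y \<omega>) + K\<^sup>2" for \<omega>
    by (simp add: power2_eq_square algebra_simps)
  have int2: "integrable M (\<lambda>\<omega>. (norm (Y \<omega>) + K)\<^sup>2)"
    unfolding expand using int int1 by simp
  show int3: "integrable M (\<lambda>\<omega>. (norm (Y \<omega> - c))\<^sup>2)"
    by (rule Bochner_Integration.integrable_bound[OF int2]) (use pointwise in auto)
  define r where "r = sqrt (\<integral>\<omega>. (norm (Y \<omega>))\<^sup>2 \<partial>M)"
  have r: "0 \<le> r" "r\<^sup>2 = (\<integral>\<omega>. (norm (Y \<omega>))\<^sup>2 \<partial>M)"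
    by (auto simp: r_def)
  have "(\<integral>\<omega>. norm (Y \<omega>) \<partial>M)\<^sup>2 \<le> r\<^sup>2"
    using variance_eq[OF int1 int] variance_positive[of "\<lambda>\<omega>. norm (Y \<omega>)"] r by simp
  then have "(\<integral>\<omega>. norm (Y \<omega>) \<partial>M) \<le> r"
    by (rule power2_le_imp_le) (rule r(1))
  then have "2 * K * (\<integral>\<omega>. norm (Y \<omega>) \<partial>M) \<le> 2 * K * r"
    using \<open>0 \<le> K\<close> by (intro mult_left_mono) auto
  moreover have "(\<integral>\<omega>. (norm (Y \<omega>) + K)\<^sup>2 \<partial>M) = r\<^sup>2 + 2 * K * (\<integral>\<omega>. norm (Y \<omega>) \<partial>M) + K\<^sup>2"
    unfolding expand using int int1 r by (simp add: prob_space)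
  moreover have "(\<integral>\<omega>. (norm (Y \<omega> - c))\<^sup>2 \<partial>M) \<le> (\<integral>\<omega>. (norm (Y \<omega>) + K)\<^sup>2 \<partial>M)"
    using int2 int3 pointwise by (intro integral_mono) auto
  ultimately have "(\<integral>\<omega>. (norm (Y \<omega> - c))\<^sup>2 \<partial>M) \<le> (r + K)\<^sup>2"
    by (simp add: power2_sum mult_ac)
  then show "sqrt (\<integral>\<omega>. (norm (Y \<omega> - c))\<^sup>2 \<partial>M) \<le> sqrt (\<integral>\<omega>. (norm (Y \<omega>))\<^sup>2 \<partial>M) + K"
    using r \<open>0 \<le> K\<close> unfolding r_def[symmetric] by (intro real_le_lsqrt) auto
qed

text \<open>Unrolled from time 1, the recursion gives
  \<open>r (n + 1) \<le> q ^ n r 1 + b / (1 - q)\<close>, where \<open>b / (1 - q)\<close> is the fixed point of the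
  affine map.\<close>

lemma affine_recursion_limsup:
  fixes r :: "nat \<Rightarrow> real"
  assumes step: "\<And>t. 1 \<le> t \<Longrightarrow> r (Suc t) \<le> q * r t + b"
    and "0 \<le> q" "q < 1" "0 \<le> b"
  shows "limsup (\<lambda>t. ereal (r t)) \<le> ereal (b / (1 - q))"
proof -
  have bound: "r (Suc n) \<le> q ^ n * r 1 + b / (1 - q)" for n
  proof (induction n)
    case 0
    then show ?case using assms by simp
  next
    case (Suc n)
    have "r (Suc (Suc n)) \<le> q * r (Suc n) + b" by (rule step) simp
    also have "\<dots> \<le> q * (q ^ n * r 1 + b / (1 - q)) + b"
      using Suc assms by (intro add_right_mono mult_left_mono) auto
    also have "\<dots> = q ^ Suc n * r 1 + b / (1 - q)"
      using assms by (simp add: field_simps)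
    finally show ?case .
  qed
  have "(\<lambda>n. q ^ n * r 1 + b / (1 - q)) \<longlonglongrightarrow> 0 * r 1 + b / (1 - q)"
    using assms by (intro tendsto_intros LIMSEQ_realpow_zero) auto
  then have "(\<lambda>n. ereal (q ^ n * r 1 + b / (1 - q))) \<longlonglongrightarrow> ereal (b / (1 - q))"
    by simp
  then have "limsup (\<lambda>n. ereal (q ^ n * r 1 + b / (1 - q))) = ereal (b / (1 - q))"
    by (intro lim_imp_Limsup) auto
  moreover have "limsup (\<lambda>n. ereal (r (Suc n))) \<le> limsup (\<lambda>n. ereal (q ^ n * r 1 + b / (1 - q)))"
    using bound by (intro Limsup_mono always_eventually) auto
  moreover have "limsup (\<lambda>n. ereal (r (n + 1))) = limsup (\<lambda>n. ereal (r n))"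
    by (rule limsup_shift[of "\<lambda>n. ereal (r n)"])
  ultimately show ?thesis by simp
qed

section \<open>The contraction factor and the bound as functions of the step size\<close>

text \<open>As a function of \<open>L \<alpha>\<close> the squared factor is a parabola with vertex at 1/2 and value 1
  at 0 and 1. So the factor is below 1 for \<open>0 < L \<alpha> < 1\<close> and increases from
  \<open>L \<alpha> = 1/2\<close> on.\<close>

lemma contraction_factor_eq:
  "contraction_factor \<alpha> L = sqrt ((1 - L * \<alpha>)\<^sup>2 + (L * \<alpha>)\<^sup>2)"
  unfolding contraction_factor_def
  by (rule arg_cong[where f=sqrt]) (simp add: power2_eq_square algebra_simps)

lemma contraction_factor_nonneg: "0 \<le> contraction_factor \<alpha> L"
  by (simp add: contraction_factor_eq)

lemma contraction_factor_less_1: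
  assumes "0 < L" "0 < \<alpha>" "\<alpha> < 1 / L"
  shows "contraction_factor \<alpha> L < 1"
proof -
  have "0 < L * \<alpha>" "L * \<alpha> < 1" using assms by (auto simp: field_simps)
  then have "0 < (L * \<alpha>) * (1 - L * \<alpha>)" by simp
  then have "(1 - L * \<alpha>)\<^sup>2 + (L * \<alpha>)\<^sup>2 < 1" by (simp add: power2_eq_square algebra_simps)
  then show ?thesis by (simp add: contraction_factor_eq)
qed

lemma contraction_factor_mono:
  assumes "0 < L" "1 / (2 * L) \<le> \<alpha>" "\<alpha> \<le> \<beta>"
  shows "contraction_factor \<alpha> L \<le> contraction_factor \<beta> L"
proof -
  have "1 \<le> 2 * (L * \<alpha>)" "L * \<alpha> \<le> L * \<beta>" using assms by (auto simp: field_simps)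
  then have "0 \<le> 2 * ((L * \<beta> - L * \<alpha>) * (L * \<alpha> + L * \<beta> - 1))" by simp
  then have "(1 - L * \<alpha>)\<^sup>2 + (L * \<alpha>)\<^sup>2 \<le> (1 - L * \<beta>)\<^sup>2 + (L * \<beta>)\<^sup>2"
    by (simp add: power2_eq_square algebra_simps)
  then show ?thesis by (simp add: contraction_factor_eq)
qed

lemma contraction_factor_smallest_step:
  assumes "0 < l" "0 < L"
  shows "contraction_factor (1 / (l + L)) L = sqrt (l\<^sup>2 + L\<^sup>2) / (l + L)"
proof -
  have "1 - L * (1 / (l + L)) = l / (l + L)" using assms by (simp add: field_simps)
  then have "contraction_factor (1 / (l + L)) L = sqrt ((l\<^sup>2 + L\<^sup>2) / (l + L)\<^sup>2)"
    by (simp add: contraction_factor_eq power_divide add_divide_distrib)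
  then show ?thesis using assms by (simp add: real_sqrt_divide)
qed

text \<open>Beyond \<open>1 / (2 L)\<close> the contraction factor increases with the step size, so the numerator
  of the bound grows and its positive denominator shrinks.\<close>

lemma tracking_bound_mono:
  assumes "0 < L" "0 \<le> K" "1 / (2 * L) \<le> \<alpha>" "\<alpha> \<le> \<beta>" "\<beta> < 1 / L"
  shows "tracking_bound d L K \<alpha> \<le> tracking_bound d L K \<beta>"
proof -
  have "0 < 1 / (2 * L)" using assms by simp
  then have "0 < \<alpha>" "0 < \<beta>" using assms by linarith+
  then show ?thesis
    unfolding tracking_bound_def
    using assms contraction_factor_mono[OF assms(1,3,4)] contraction_factor_less_1[of L \<beta>]
      contraction_factor_nonneg
    by (intro frac_le add_mono mult_right_mono add_nonneg_nonneg mult_nonneg_nonneg) auto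
qed

lemma tracking_bound_smallest_step:
  assumes "0 < l" "0 < L"
  shows "tracking_bound d L K (1 / (l + L)) =
    (K * sqrt (l\<^sup>2 + L\<^sup>2) + sqrt (2 * real d * L)) / (l + L - sqrt (l\<^sup>2 + L\<^sup>2))"
proof -
  define q where "q = sqrt (l\<^sup>2 + L\<^sup>2)"
  define w where "w = sqrt (2 * real d * L)"
  have "0 < l + L" using assms by simp
  then have "q / (l + L) * K + 1 / (l + L) * w = (K * q + w) / (l + L)"
    "1 - q / (l + L) = (l + L - q) / (l + L)"
    by (simp_all add: add_divide_distrib diff_divide_distrib mult.commute)
  then have "(q / (l + L) * K + 1 / (l + L) * w) / (1 - q / (l + L)) = (K * q + w) / (l + L - q)"
    using \<open>0 < l + L\<close> by simp
  then show ?thesis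
    unfolding tracking_bound_def contraction_factor_smallest_step[OF assms]
    by (simp add: q_def w_def)
qed

section \<open>The tracking error\<close>

text \<open>The recursion for the root mean square errors. Let \<open>a t\<close> be the error before and
  \<open>b t\<close> the error after the step that uses the observation at time \<open>t\<close>, both relative
  to the target at time \<open>t\<close>. Taking the mean of the deterministic one-step estimate
  removes the cross term, by independence, and yields
  \<open>|b t| \<le> q |a t| + \<alpha> w\<close> in the \<open>L\<^sup>2\<close> norm, with \<open>q\<close> the contraction factor and
  \<open>w\<^sup>2 = 2 d L\<close> twice the bound on the second moment of the score; moving on to the next target costs at
  most the drift \<open>K\<close>.\<close>

lemma limsup_tracking_error:
  fixes M :: "'w measure"
    and p :: "'x::euclidean_space \<Rightarrow> real^'d::finite \<Rightarrow> real"
  assumes "prob_space M"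
    and density: "\<And>\<theta>. prob_density (\<lambda>x. p x \<theta>)"
    and density_pos: "\<And>x \<theta>. p x \<theta> > 0"
    and indep: "prob_space.indep_vars M (\<lambda>_. borel) X {1..}"
    and X_density: "\<And>t. t \<ge> 1 \<Longrightarrow> distributed M lborel (X t) (\<lambda>x. ennreal (p x (\<theta>star t)))"
    and smooth: "\<And>x. twice_cont_diff (\<lambda>\<theta>. ln (p x \<theta>))"
    and "l > 0"
    and strong_convex: "\<And>x \<theta>. pos_semidef (hessian (\<lambda>\<theta>'. - ln (p x \<theta>')) \<theta> - l *\<^sub>R mat 1)"
    and "L > 0"
    and lipschitz_grad: "\<And>x \<xi>\<^sub>1 \<xi>\<^sub>2.
        norm (grad (\<lambda>\<theta>. ln (p x \<theta>)) \<xi>\<^sub>1 - grad (\<lambda>\<theta>. ln (p x \<theta>)) \<xi>\<^sub>2) \<le> L * norm (\<xi>\<^sub>1 - \<xi>\<^sub>2)"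
    and drift: "\<And>t. t \<ge> 1 \<Longrightarrow> norm (\<theta>star (Suc t) - \<theta>star t) \<le> K"
    and \<alpha>: "1 / (l + L) \<le> \<alpha>" "\<alpha> < 1 / L"
  shows "limsup (\<lambda>t. L2_norm M (\<lambda>\<omega>. iterate p X \<alpha> \<theta>\<^sub>1 (Suc t) \<omega> - \<theta>star t))
    \<le> ereal (tracking_bound CARD('d) L K \<alpha>)"
proof -
  interpret prob_space M by fact
  define S where "S x = grad (\<lambda>\<theta>. ln (p x \<theta>))" for x
  define q where "q = contraction_factor \<alpha> L"
  define w where "w = sqrt (2 * real CARD('d) * L)"
  have "0 < 1 / (l + L)" using \<open>0 < l\<close> \<open>0 < L\<close> by simp
  then have "0 < \<alpha>" using \<alpha>(1) by linarith
  have q: "0 \<le> q" "q < 1"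
    using contraction_factor_nonneg contraction_factor_less_1[OF \<open>0 < L\<close> \<open>0 < \<alpha>\<close> \<alpha>(2)]
    by (auto simp: q_def)
  have "0 \<le> K" using drift[of 1] norm_ge_zero[of "\<theta>star (Suc 1) - \<theta>star 1"] by linarith
  have w: "0 \<le> w" "w\<^sup>2 = 2 * real CARD('d) * L"
    using \<open>0 < L\<close> by (auto simp: w_def)
  have diff: "(\<lambda>\<theta>. ln (p x \<theta>)) differentiable (at \<theta>)" for x \<theta>
    by (rule twice_cont_diffD[OF smooth])
  have S_meas: "(\<lambda>x. S x \<theta>) \<in> borel_measurable borel" for \<theta>
    unfolding S_def
  proof (rule borel_measurable_grad[OF _ diff])
    show "(\<lambda>x. ln (p x \<theta>)) \<in> borel_measurable borel" for \<theta>
      using density[of \<theta>] by (auto simp: prob_density_def intro: borel_measurable_ln)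
  qed
  have S_cont: "continuous_on UNIV (S x)" for x
    using smooth[of x]
    by (auto simp: S_def twice_cont_diff_def intro: differentiable_imp_continuous_on)
  have X_meas: "X t \<in> borel_measurable M" if "1 \<le> t" for t
    using distributed_measurable[OF X_density[OF that]] by simp
  have iter_meas[measurable]: "iterate p X \<alpha> \<theta>\<^sub>1 t \<in> borel_measurable M" for t
    by (rule borel_measurable_iterate[where S=borel, OF S_meas[unfolded S_def] S_cont[unfolded S_def] X_meas])
  have convex: "l * (norm (y - z))\<^sup>2 \<le> (- S x y - - S x z) \<bullet> (y - z)" for x y z
    unfolding S_def by (rule strongly_monotone_score[OF smooth strong_convex])
  have Lipschitz: "norm (- S x y - - S x z) \<le> L * norm (y - z)" for x y z
    using lipschitz_grad[of x y z] by (simp add: S_def norm_minus_commute)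
  have "l \<le> L"
    using convexity_modulus_le_Lipschitz[OF convex Lipschitz] .
  define a where "a t \<omega> = iterate p X \<alpha> \<theta>\<^sub>1 t \<omega> - \<theta>star t" for t \<omega>
  define b where "b t \<omega> = iterate p X \<alpha> \<theta>\<^sub>1 (Suc t) \<omega> - \<theta>star t" for t \<omega>
  define e where "e t = sqrt (\<integral>\<omega>. (norm (a t \<omega>))\<^sup>2 \<partial>M)" for t
  define r where "r t = sqrt (\<integral>\<omega>. (norm (b t \<omega>))\<^sup>2 \<partial>M)" for t
  have meas[measurable]: "a t \<in> borel_measurable M" "b t \<in> borel_measurable M" for t
    unfolding a_def b_def by measurable
  have ascent: "integrable M (\<lambda>\<omega>. (norm (b t \<omega>))\<^sup>2) \<and> r t \<le> q * e t + \<alpha> * w"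
    if t: "1 \<le> t" and int_a: "integrable M (\<lambda>\<omega>. (norm (a t \<omega>))\<^sup>2)" for t
  proof -
    define u where "u \<omega> = S (X t \<omega>) (\<theta>star t)" for \<omega>
    note score = score_moments[OF \<open>prob_space M\<close> density density_pos diff lipschitz_grad
        X_density[OF t] S_meas[unfolded S_def], folded S_def, folded u_def]
    have int_ai: "integrable M (\<lambda>\<omega>. a t \<omega> $ i)" for i
    proof (rule square_integrable_imp_integrable)
      have "(\<lambda>\<omega>. a t \<omega> \<bullet> axis i 1) \<in> borel_measurable M" by measurable
      then show 1: "(\<lambda>\<omega>. a t \<omega> $ i) \<in> borel_measurable M" by (simp add: inner_axis)
      show "integrable M (\<lambda>\<omega>. (a t \<omega> $ i)\<^sup>2)"
      proof (rule Bochner_Integration.integrable_bound[OF int_a])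
        show "(\<lambda>\<omega>. (a t \<omega> $ i)\<^sup>2) \<in> borel_measurable M" using 1 by measurable
        have "(a t \<omega> $ i)\<^sup>2 \<le> (norm (a t \<omega>))\<^sup>2" for \<omega>
          using power_mono[OF component_le_norm_cart[of "a t \<omega>" i], of 2] by simp
        then show "AE \<omega> in M. norm ((a t \<omega> $ i)\<^sup>2) \<le> norm ((norm (a t \<omega>))\<^sup>2)" by simp
      qed
    qed
    have vec_nth_meas: "(\<lambda>v::real^'d. v $ i) \<in> borel_measurable borel" for i
      by (intro borel_measurable_continuous_onI continuous_intros)
    have indep_au: "indep_var borel (\<lambda>\<omega>. a t \<omega> $ i) borel (\<lambda>\<omega>. u \<omega> $ i)" for i
      unfolding a_def u_def
    proof (rule indep_iterate_observation[OF \<open>prob_space M\<close> indep S_meas[unfolded S_def] S_cont[unfolded S_def] t])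
      show "(\<lambda>v. (v - \<theta>star t) $ i) \<in> borel_measurable borel"
        by (rule measurable_compose[OF _ vec_nth_meas]) measurable
      show "(\<lambda>x. S x (\<theta>star t) $ i) \<in> borel_measurable borel"
        by (rule measurable_compose[OF S_meas vec_nth_meas])
    qed
    note cross = orthogonal_in_mean[OF \<open>prob_space M\<close> indep_au int_ai score(1,2)]
    \<comment> \<open>The pointwise majorant of the squared error after the step.\<close>
    define R where "R \<omega> = q\<^sup>2 * (norm (a t \<omega>))\<^sup>2 + 2 * \<alpha> * (a t \<omega> \<bullet> u \<omega>) + 2 * \<alpha>\<^sup>2 * (norm (u \<omega>))\<^sup>2" for \<omega>
    have pointwise: "(norm (b t \<omega>))\<^sup>2 \<le> R \<omega>" for \<omega>
    proof -
      define D where "D = - S (X t \<omega>) (iterate p X \<alpha> \<theta>\<^sub>1 t \<omega>) - - S (X t \<omega>) (\<theta>star t)"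
      have "GDERIV (\<lambda>\<theta>. - ln (p (X t \<omega>) \<theta>)) z :> - S (X t \<omega>) z" for z
        unfolding S_def by (rule GDERIV_minus[OF GDERIV_grad[OF diff]])
      from gradient_interpolation[OF this convex Lipschitz less_imp_le[OF \<open>0 < l\<close>] \<open>l \<le> L\<close>]
      have "l * L * (norm (a t \<omega>))\<^sup>2 + (norm D)\<^sup>2 \<le> (l + L) * (D \<bullet> a t \<omega>)"
        by (simp add: D_def a_def)
      moreover have "norm D \<le> L * norm (a t \<omega>)"
        unfolding D_def a_def by (rule Lipschitz)
      ultimately have "(norm (a t \<omega> - \<alpha> *\<^sub>R (D + (- u \<omega>))))\<^sup>2 \<le> R \<omega>"
        using contraction_step[of l L "a t \<omega>" D \<alpha> "- u \<omega>"] \<open>0 < l\<close> \<open>0 < L\<close> \<alpha>(1)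
        by (simp add: R_def q_def)
      moreover have "a t \<omega> - \<alpha> *\<^sub>R (D + (- u \<omega>)) = b t \<omega>"
        using t by (simp add: a_def b_def D_def u_def S_def)
      ultimately show ?thesis by simp
    qed
    have int_R: "integrable M R"
      unfolding R_def using int_a cross(1) score(3) by simp
    have int_b: "integrable M (\<lambda>\<omega>. (norm (b t \<omega>))\<^sup>2)"
    proof (rule Bochner_Integration.integrable_bound[OF int_R])
      show "(\<lambda>\<omega>. (norm (b t \<omega>))\<^sup>2) \<in> borel_measurable M" by measurable
      have "norm ((norm (b t \<omega>))\<^sup>2) \<le> norm (R \<omega>)" for \<omega>
        using pointwise[of \<omega>] by simp
      then show "AE \<omega> in M. norm ((norm (b t \<omega>))\<^sup>2) \<le> norm (R \<omega>)" by simp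
    qed
    have e: "0 \<le> e t" "(e t)\<^sup>2 = (\<integral>\<omega>. (norm (a t \<omega>))\<^sup>2 \<partial>M)"
      by (auto simp: e_def)
    have "(\<integral>\<omega>. (norm (b t \<omega>))\<^sup>2 \<partial>M) \<le> (\<integral>\<omega>. R \<omega> \<partial>M)"
      using int_b int_R pointwise by (rule integral_mono)
    also have "\<dots> = q\<^sup>2 * (e t)\<^sup>2 + 2 * \<alpha>\<^sup>2 * (\<integral>\<omega>. (norm (u \<omega>))\<^sup>2 \<partial>M)"
      unfolding R_def using int_a cross score(3) e by simp
    also have "\<dots> \<le> q\<^sup>2 * (e t)\<^sup>2 + 2 * \<alpha>\<^sup>2 * (real CARD('d) * L)"
      using score(4) by (intro add_left_mono mult_left_mono) auto
    also have "\<dots> = (q * e t)\<^sup>2 + (\<alpha> * w)\<^sup>2"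
      by (simp add: power_mult_distrib w)
    also have "\<dots> \<le> (q * e t + \<alpha> * w)\<^sup>2"
      using q e w \<open>0 < \<alpha>\<close> by (simp add: power2_sum)
    finally have "r t \<le> q * e t + \<alpha> * w"
      unfolding r_def using q e w \<open>0 < \<alpha>\<close> by (intro real_le_lsqrt) auto
    with int_b show ?thesis by blast
  qed
  have moved: "integrable M (\<lambda>\<omega>. (norm (a (Suc t) \<omega>))\<^sup>2) \<and> e (Suc t) \<le> r t + K"
    if "1 \<le> t" "integrable M (\<lambda>\<omega>. (norm (b t \<omega>))\<^sup>2)" for t
  proof -
    have "a (Suc t) \<omega> = b t \<omega> - (\<theta>star (Suc t) - \<theta>star t)" for \<omega>
      by (simp add: a_def b_def)
    then show ?thesis
      using L2_translate[OF \<open>prob_space M\<close> meas(2) that(2) drift[OF that(1)]]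
      by (simp add: e_def r_def)
  qed
  have int_a: "integrable M (\<lambda>\<omega>. (norm (a t \<omega>))\<^sup>2)" if "1 \<le> t" for t
    using that
  proof (induction t rule: nat_induct_at_least)
    case base
    show ?case by (simp add: a_def)
  next
    case (Suc t)
    then show ?case using ascent moved by blast
  qed
  have int_b: "integrable M (\<lambda>\<omega>. (norm (b t \<omega>))\<^sup>2)" if "1 \<le> t" for t
    using ascent[OF that int_a[OF that]] by blast
  have "limsup (\<lambda>t. ereal (r t)) \<le> ereal ((q * K + \<alpha> * w) / (1 - q))"
  proof (rule affine_recursion_limsup)
    fix t :: nat
    assume t: "1 \<le> t"
    have "r (Suc t) \<le> q * e (Suc t) + \<alpha> * w"
      using ascent[of "Suc t"] int_a[of "Suc t"] by simp
    also have "\<dots> \<le> q * (r t + K) + \<alpha> * w"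
      using moved[OF t int_b[OF t]] q by (intro add_right_mono mult_left_mono) auto
    finally show "r (Suc t) \<le> q * r t + (q * K + \<alpha> * w)"
      by (simp add: algebra_simps)
  qed (use q w \<open>0 \<le> K\<close> \<open>0 < \<alpha>\<close> in auto)
  moreover have "L2_norm M (b t) = ereal (r t)" if "1 \<le> t" for t
    using int_b[OF that] by (simp add: L2_norm_def r_def)
  then have "limsup (\<lambda>t. L2_norm M (b t)) = limsup (\<lambda>t. ereal (r t))"
    by (intro Limsup_eq eventually_sequentiallyI[of 1])
  ultimately show ?thesis
    by (simp add: tracking_bound_def q_def w_def b_def[abs_def] del: iterate.simps)
qed

theorem theorem2p6:
  fixes M :: "'w measure"
    and p :: "real^'m::finite \<Rightarrow> real^'d::finite \<Rightarrow> real"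
    and X :: "nat \<Rightarrow> 'w \<Rightarrow> real^'m"
    and \<theta>star :: "nat \<Rightarrow> real^'d"
    and \<theta>\<^sub>1 :: "real^'d"
    and l L K :: real
  assumes "prob_space M"
    and density: "\<And>\<theta>. prob_density (\<lambda>x. p x \<theta>)"
    and density_pos: "\<And>x \<theta>. p x \<theta> > 0"
    and indep: "prob_space.indep_vars M (\<lambda>_. borel) X {1..}"
    and X_density: "\<And>t. t \<ge> 1 \<Longrightarrow> distributed M lborel (X t) (\<lambda>x. ennreal (p x (\<theta>star t)))"
    and smooth: "\<And>x. twice_cont_diff (\<lambda>\<theta>. ln (p x \<theta>))"
    and ln_integrable: "\<And>t \<theta>. t \<ge> 1 \<Longrightarrow> integrable M (\<lambda>\<omega>. ln (p (X t \<omega>) \<theta>))"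
    and E_partial: "\<And>t j \<theta>. t \<ge> 1 \<Longrightarrow>
        has_partial_at j (\<lambda>\<theta>'. \<integral>\<omega>. ln (p (X t \<omega>) \<theta>') \<partial>M) \<theta>"
    and E_partial2: "\<And>t i j \<theta>. t \<ge> 1 \<Longrightarrow>
        has_partial_at i (partial j (\<lambda>\<theta>'. \<integral>\<omega>. ln (p (X t \<omega>) \<theta>') \<partial>M)) \<theta>"
    and partial2_integrable: "\<And>t i j \<theta>. t \<ge> 1 \<Longrightarrow>
        integrable M (\<lambda>\<omega>. partial i (partial j (\<lambda>\<theta>'. ln (p (X t \<omega>) \<theta>'))) \<theta>)"
    and interchange: "\<And>t i j \<theta>. t \<ge> 1 \<Longrightarrow>
        partial i (partial j (\<lambda>\<theta>'. \<integral>\<omega>. ln (p (X t \<omega>) \<theta>') \<partial>M)) \<theta> =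
        (\<integral>\<omega>. partial i (partial j (\<lambda>\<theta>'. ln (p (X t \<omega>) \<theta>'))) \<theta> \<partial>M)"
    and l_pos: "l > 0"
    and strong_convex: "\<And>x \<theta>. pos_semidef (hessian (\<lambda>\<theta>'. - ln (p x \<theta>')) \<theta> - l *\<^sub>R mat 1)"
    and L_pos: "L > 0"
    and lipschitz_grad: "\<And>x \<xi>\<^sub>1 \<xi>\<^sub>2.
        norm (grad (\<lambda>\<theta>. ln (p x \<theta>)) \<xi>\<^sub>1 - grad (\<lambda>\<theta>. ln (p x \<theta>)) \<xi>\<^sub>2) \<le> L * norm (\<xi>\<^sub>1 - \<xi>\<^sub>2)"
    and K_pos: "K > 0"
    and drift: "\<And>t. t \<ge> 1 \<Longrightarrow> norm (\<theta>star (Suc t) - \<theta>star t) \<le> K"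
  shows "(\<forall>\<alpha>\<in>{1 / (l + L)..<1 / L}.
            limsup (\<lambda>t. L2_norm M (\<lambda>\<omega>. iterate p X \<alpha> \<theta>\<^sub>1 (Suc t) \<omega> - \<theta>star t))
              \<le> ereal (tracking_bound CARD('d) L K \<alpha>)) \<and>
         is_arg_min (tracking_bound CARD('d) L K) (\<lambda>\<alpha>. \<alpha> \<in> {1 / (l + L)..<1 / L}) (1 / (l + L)) \<and>
         tracking_bound CARD('d) L K (1 / (l + L)) =
           (K * sqrt (l\<^sup>2 + L\<^sup>2) + sqrt (2 * real CARD('d) * L)) / (l + L - sqrt (l\<^sup>2 + L\<^sup>2)) \<and>
         limsup (\<lambda>t. L2_norm M (\<lambda>\<omega>. iterate p X (1 / (l + L)) \<theta>\<^sub>1 (Suc t) \<omega> - \<theta>star t))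
           \<le> ereal ((K * sqrt (l\<^sup>2 + L\<^sup>2) + sqrt (2 * real CARD('d) * L)) / (l + L - sqrt (l\<^sup>2 + L\<^sup>2)))"
proof -
  have "l \<le> L"
  proof (rule convexity_modulus_le_Lipschitz)
    show "l * (norm (y - z))\<^sup>2
        \<le> (- grad (\<lambda>\<theta>. ln (p undefined \<theta>)) y - - grad (\<lambda>\<theta>. ln (p undefined \<theta>)) z) \<bullet> (y - z)" for y z
      by (rule strongly_monotone_score[OF smooth strong_convex])
    show "norm (- grad (\<lambda>\<theta>. ln (p undefined \<theta>)) y - - grad (\<lambda>\<theta>. ln (p undefined \<theta>)) z)
        \<le> L * norm (y - z)" for y z
      using lipschitz_grad[of undefined y z] by (simp add: norm_minus_commute)
  qed
  have bound: "limsup (\<lambda>t. L2_norm M (\<lambda>\<omega>. iterate p X \<alpha> \<theta>\<^sub>1 (Suc t) \<omega> - \<theta>star t))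
      \<le> ereal (tracking_bound CARD('d) L K \<alpha>)" if "\<alpha> \<in> {1 / (l + L)..<1 / L}" for \<alpha>
    using that
    by (intro limsup_tracking_error[OF \<open>prob_space M\<close> density density_pos indep X_density smooth
          l_pos strong_convex L_pos lipschitz_grad drift]) auto
  have smallest: "1 / (l + L) \<in> {1 / (l + L)..<1 / L}"
    using l_pos L_pos by (simp add: frac_less2)
  have "1 / (2 * L) \<le> 1 / (l + L)"
    using \<open>l \<le> L\<close> l_pos L_pos by (intro frac_le) auto
  then have "tracking_bound CARD('d) L K (1 / (l + L)) \<le> tracking_bound CARD('d) L K \<beta>"
    if "\<beta> \<in> {1 / (l + L)..<1 / L}" for \<beta>
    using that L_pos K_pos by (intro tracking_bound_mono) auto
  then have "is_arg_min (tracking_bound CARD('d) L K) (\<lambda>\<alpha>. \<alpha> \<in> {1 / (l + L)..<1 / L}) (1 / (l + L))"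
    using smallest by (auto simp: is_arg_min_linorder)
  moreover note bound_value = tracking_bound_smallest_step[OF l_pos L_pos, of "CARD('d)" K]
  moreover note bound[OF smallest, unfolded bound_value]
  ultimately show ?thesis using bound by blast
qed

end
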